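(* Let $n$ be a positive integer. Then $$\lambda(1,3;n+1)=\frac12\sum_{x,y\in\mathbb{Z},\ x^2+3y^2=2n+1}(x^2-3y^2)$$ and $$\lambda(1,7;2n+1)=\frac12\sum_{x,y\in\mathbb{Z},\ x^2+7y^2=2n+1}(x^2-7y^2).$$
   Context: For positive integers $a,b,n$, $\lambda(a,b;n)$ is the integer defined by the power series expansion $q\prod_{k=1}^{\infty}(1-q^{ak})^3(1-q^{bk})^3=\sum_{n=1}^{\infty}\lambda(a,b;n)q^n$ for $|q|<1$. *)

theory Defs
  imports "HOL-Complex_Analysis.Complex_Analysis"
begin

text \<open>The infinite product starts at \<open>k = 1\<close>, so its factors are shifted by \<^const>\<open>Suc\<close>
  (as \<^const>\<open>prodinf\<close> starts at \<open>0\<close>).\<close>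

definition eta_cube_prod :: "nat \<Rightarrow> nat \<Rightarrow> complex \<Rightarrow> complex" where
  "eta_cube_prod a b q =
     q * (\<Prod>k. (1 - q ^ (a * Suc k)) ^ 3 * (1 - q ^ (b * Suc k)) ^ 3)"

text \<open>The expansion determines \<open>\<lambda>(a,b;n)\<close> only for \<open>n \<ge> 1\<close>; the value at \<open>n = 0\<close> is fixed
  to be \<open>0\<close>. For positive \<open>a\<close> and \<open>b\<close> such a sequence of integers exists and is unique
  (\<open>lambda_coeff_ex1\<close>), so the definite description denotes it.\<close>

definition lambda_coeff :: "nat \<Rightarrow> nat \<Rightarrow> nat \<Rightarrow> int" where
  "lambda_coeff a b = (THE c :: nat \<Rightarrow> int. c 0 = 0 \<and>
     (\<forall>q :: complex. norm q < 1 \<longrightarrow>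
        (\<lambda>n. of_int (c (Suc n)) * q ^ Suc n) sums eta_cube_prod a b q))"

lemma prod_cubes:
  "(1 - x :: 'a :: comm_ring_1) ^ 3 * (1 - y) ^ 3 = (\<Prod>i<6. 1 + (if i < (3::nat) then - x else - y))"
proof -
  have "{..<6::nat} = {0, 1, 2, 3, 4, 5}" by auto
  thus ?thesis by (simp add: power3_eq_cube mult.assoc)
qed

lemma norm_factor_minus_1_le:
  fixes q :: complex
  assumes "a > 0" "b > 0" "norm q \<le> r" "r < 1"
  shows "norm ((1 - q ^ (a * Suc k)) ^ 3 * (1 - q ^ (b * Suc k)) ^ 3 - 1) \<le> 63 * r ^ k"
proof -
  have r0: "r \<ge> 0" using assms(3) norm_ge_zero order_trans by blast
  define t where "t = r ^ k"
  have t: "0 \<le> t" "t \<le> 1"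
    using r0 assms(4) by (auto simp: t_def power_le_one)
  have le: "norm (q ^ (m * Suc k)) \<le> t" if "m > 0" for m
  proof -
    have "norm (q ^ (m * Suc k)) \<le> r ^ (m * Suc k)"
      using assms(3) by (simp add: norm_power power_mono del: mult_Suc_right)
    also have "k \<le> m * Suc k"
    proof (cases m)
      case (Suc j)
      then show ?thesis by simp
    qed (use that in simp)
    hence "r ^ (m * Suc k) \<le> r ^ k"
      using r0 assms(4) by (intro power_decreasing) auto
    finally show ?thesis by (simp add: t_def)
  qed
  define g where "g i = (if i < (3::nat) then - (q ^ (a * Suc k)) else - (q ^ (b * Suc k)))" for i
  have g: "norm (g i) \<le> t" for i
    using le[OF assms(1)] le[OF assms(2)] by (auto simp: g_def simp del: mult_Suc_right)
  have eq: "(1 - q ^ (a * Suc k)) ^ 3 * (1 - q ^ (b * Suc k)) ^ 3 = (\<Prod>i<6. 1 + g i)"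
    by (simp only: prod_cubes g_def)
  have "norm ((\<Prod>i<6. 1 + g i) - 1) \<le> (\<Prod>i<6. 1 + norm (g i)) - 1"
    by (rule norm_prod_minus1_le_prod_minus1)
  also have "(\<Prod>i<6. 1 + norm (g i)) \<le> (\<Prod>i<(6::nat). 1 + t)"
    using g by (intro prod_mono) (auto intro: add_nonneg_nonneg)
  also have "(\<Prod>i<(6::nat). 1 + t) = (1 + t) ^ 6" by simp
  also have "(1 + t) ^ 6 - 1 = t * (6 + 15 * t + 20 * t^2 + 15 * t^3 + 6 * t^4 + t^5)"
    by (simp add: eval_nat_numeral algebra_simps)
  also have "\<dots> \<le> t * (6 + 15 * 1 + 20 * 1 + 15 * 1 + 6 * 1 + 1)"
    using t by (intro mult_left_mono add_mono order.refl power_le_one) auto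
  finally show ?thesis unfolding eq t_def by simp
qed

lemma uniform_limit_eta_cube_prod:
  assumes "a > 0" "b > 0" "r < 1"
  shows "uniform_limit (cball 0 r)
           (\<lambda>N q. q * (\<Prod>k<N. (1 - q ^ (a * Suc k)) ^ 3 * (1 - q ^ (b * Suc k)) ^ 3))
           (eta_cube_prod a b) sequentially"
proof (cases "r < 0")
  case False
  hence r: "0 \<le> r" by simp
  define f where "f = (\<lambda>k q::complex. (1 - q ^ (a * Suc k)) ^ 3 * (1 - q ^ (b * Suc k)) ^ 3)"
  have bd: "norm (f k q - 1) \<le> 63 * r ^ k" if "q \<in> cball 0 r" for k q
    using norm_factor_minus_1_le[OF assms(1,2) _ assms(3), of q k] that by (simp add: f_def)
  have sm: "summable (\<lambda>k. 63 * r ^ k)"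
    using r assms(3) by (intro summable_mult summable_geometric) auto
  have "uniformly_convergent_on (cball 0 r) (\<lambda>N q. \<Prod>k<N. f k q)"
  proof (rule uniformly_convergent_on_prod')
    show "continuous_on (cball 0 r) (f n)" for n
      unfolding f_def by (intro continuous_intros)
    show "uniformly_convergent_on (cball 0 r) (\<lambda>N q. \<Sum>n<N. norm (f n q - 1))"
      using bd sm by (intro Weierstrass_m_test'[where M = "\<lambda>k. 63 * r ^ k"]) auto
  qed auto
  from this[unfolded uniformly_convergent_on_def]
  obtain l where l: "uniform_limit (cball 0 r) (\<lambda>N q. \<Prod>k<N. f k q) l sequentially" ..
  have l_eq: "l q = (\<Prod>k. f k q)" if q: "q \<in> cball 0 r" for q
  proof -
    have "summable (\<lambda>k. norm (f k q - 1))"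
      using bd[OF q] by (intro summable_comparison_test'[OF sm, where N = 0]) simp_all
    hence "abs_convergent_prod (\<lambda>k. f k q)"
      by (simp add: abs_convergent_prod_conv_summable)
    hence "convergent_prod (\<lambda>k. f k q)"
      by (rule abs_convergent_prod_imp_convergent_prod)
    hence "(\<lambda>N. \<Prod>k\<le>N. f k q) \<longlonglongrightarrow> (\<Prod>k. f k q)"
      by (rule convergent_prod_LIMSEQ)
    hence "(\<lambda>N. \<Prod>k<N. f k q) \<longlonglongrightarrow> (\<Prod>k. f k q)"
      by (subst LIMSEQ_lessThan_iff_atMost[of "\<lambda>A. \<Prod>k\<in>A. f k q"])
    moreover have "(\<lambda>N. \<Prod>k<N. f k q) \<longlonglongrightarrow> l q"
      using tendsto_uniform_limitI[OF l q] .
    ultimately show ?thesis using LIMSEQ_unique by blast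
  qed
  have cont: "continuous_on (cball 0 r) l"
    by (rule uniform_limit_theorem[OF _ l])
       (auto intro!: always_eventually continuous_intros simp: f_def)
  have "uniform_limit (cball 0 r) (\<lambda>N q. q * (\<Prod>k<N. f k q)) (\<lambda>q. q * l q) sequentially"
  proof (rule uniform_lim_mult[OF uniform_limit_const l])
    show "bounded (l ` cball 0 r)"
      by (intro compact_imp_bounded compact_continuous_image cont) auto
  qed auto
  also have "?this \<longleftrightarrow> ?thesis"
    unfolding f_def
  proof (rule uniform_limit_cong')
    show "q * l q = eta_cube_prod a b q" if "q \<in> cball 0 r" for q
      unfolding l_eq[OF that] by (simp only: eta_cube_prod_def f_def)
  qed simp
  finally show ?thesis .
qed auto

lemma fps_nth_prod_Ints:
  fixes f :: "'i \<Rightarrow> 'a :: comm_ring_1 fps"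
  assumes "\<And>i n. i \<in> A \<Longrightarrow> fps_nth (f i) n \<in> \<int>"
  shows "fps_nth (\<Prod>i\<in>A. f i) n \<in> \<int>"
  using assms
proof (induction A arbitrary: n rule: infinite_finite_induct)
  case (insert x A)
  then show ?case by (auto simp: fps_mult_nth intro!: Ints_sum Ints_mult)
qed auto

lemma lambda_coeff_ex1:
  assumes ab: "a > 0" "b > 0"
  shows "\<exists>!c :: nat \<Rightarrow> int. c 0 = 0 \<and>
     (\<forall>q :: complex. norm q < 1 \<longrightarrow>
        (\<lambda>n. of_int (c (Suc n)) * q ^ Suc n) sums eta_cube_prod a b q)"
proof -
  define E where "E = eta_cube_prod a b"
  define F where "F = (\<lambda>N q::complex. q * (\<Prod>k<N. (1 - q ^ (a * Suc k)) ^ 3 * (1 - q ^ (b * Suc k)) ^ 3))"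
  have hF: "F N holomorphic_on A" for N A
    unfolding F_def by (intro holomorphic_intros)
  have ul: "uniform_limit (ball 0 r) F E sequentially" if "r < 1" for r
    using uniform_limit_on_subset[OF uniform_limit_eta_cube_prod[OF ab that], of "ball 0 r"]
    by (auto simp: F_def E_def)
  have hE: "E holomorphic_on ball 0 r" if "r < 1" for r
  proof (rule holomorphic_uniform_sequence[OF open_ball hF])
    fix x :: complex
    assume x: "x \<in> ball 0 r"
    then obtain d where d: "d > 0" "cball x d \<subseteq> ball 0 r"
      using open_contains_cball open_ball by blast
    thus "\<exists>d. 0 < d \<and> cball x d \<subseteq> ball 0 r \<and> uniform_limit (cball x d) F E sequentially"
      using uniform_limit_on_subset[OF ul[OF that]] by blast
  qed
  define d where "d n = (deriv ^^ n) E 0 / fact n" for n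
  have dZ: "d n \<in> \<int>" for n
  proof (rule Lim_in_closed_set[OF closed_Ints])
    show "(\<lambda>N. (deriv ^^ n) (F N) 0 / fact n) \<longlonglongrightarrow> d n"
      unfolding d_def
      by (intro tendsto_divide tendsto_const
            higher_deriv_complex_uniform_limit[OF ul[of "1/2"]]) (auto intro: hF always_eventually)
    show "\<forall>\<^sub>F N in sequentially. (deriv ^^ n) (F N) 0 / fact n \<in> \<int>"
    proof (intro always_eventually allI)
      fix N
      define G :: "complex fps" where
        "G = fps_X * (\<Prod>k<N. (1 - fps_X ^ (a * Suc k)) ^ 3 * (1 - fps_X ^ (b * Suc k)) ^ 3)"
      have "F N has_fps_expansion G"
        unfolding F_def G_def by (intro fps_expansion_intros)
      hence "(deriv ^^ n) (F N) 0 / fact n = fps_nth G n"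
        by (simp add: fps_nth_fps_expansion)
      also have "\<dots> \<in> \<int>"
        unfolding G_def prod_cubes
      proof -
        have *: "fps_nth (1 + (if i < (3::nat) then - (fps_X ^ l) else - (fps_X ^ m))) n \<in> (\<int> :: complex set)"
          for i l m n :: nat
          by (auto simp: fps_X_power_nth)
        show "fps_nth (fps_X * (\<Prod>k<N. \<Prod>i<6. 1 + (if i < (3::nat)
                then - (fps_X ^ (a * Suc k)) else - (fps_X ^ (b * Suc k))))) n \<in> (\<int> :: complex set)"
          by (cases n) (auto intro!: fps_nth_prod_Ints * simp del: mult_Suc_right if_distrib)
      qed
      finally show "(deriv ^^ n) (F N) 0 / fact n \<in> \<int>" .
    qed
  qed auto
  define c where "c n = \<lfloor>Re (d n)\<rfloor>" for n
  have c: "of_int (c n) = d n" for n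
  proof -
    obtain z where "d n = of_int z" using dZ[of n] by (rule Ints_cases)
    thus ?thesis by (simp add: c_def)
  qed
  have sums: "(\<lambda>n. of_int (c n) * q ^ n) sums E q" if q: "norm q < 1" for q
  proof -
    obtain r where r: "norm q < r" "r < 1" using dense[OF q] by blast
    show ?thesis
      using holomorphic_power_series[OF hE[OF r(2)], of q] r by (simp add: c d_def)
  qed
  have c0: "c 0 = 0"
    by (simp add: c_def d_def E_def eta_cube_prod_def)
  have shift: "(\<lambda>n. of_int (e (Suc n)) * q ^ Suc n) sums s \<longleftrightarrow> (\<lambda>n. of_int (e n) * q ^ n) sums s"
    if "e 0 = 0" for e :: "nat \<Rightarrow> int" and q s :: complex
    using sums_Suc_iff[of "\<lambda>n. of_int (e n) * q ^ n" s] that by (simp del: power_Suc)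
  show ?thesis
  proof (rule ex1I[of _ c])
    show "c 0 = 0 \<and> (\<forall>q :: complex. norm q < 1 \<longrightarrow>
        (\<lambda>n. of_int (c (Suc n)) * q ^ Suc n) sums eta_cube_prod a b q)"
      using sums c0 unfolding shift[of c, OF c0] E_def by blast
  next
    fix c' :: "nat \<Rightarrow> int"
    assume c': "c' 0 = 0 \<and> (\<forall>q :: complex. norm q < 1 \<longrightarrow>
        (\<lambda>n. of_int (c' (Suc n)) * q ^ Suc n) sums eta_cube_prod a b q)"
    have s': "(\<lambda>n. of_int (c' n) * q ^ n) sums E q" if "norm q < 1" for q
      using c' that shift[of c' q "E q"] unfolding E_def by blast
    have "c' m = c m" for m
    proof (rule ccontr)
      assume m: "c' m \<noteq> c m"
      have "m > 0" using m c' c0 by (cases m) auto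
      have z: "(\<lambda>n. of_int (c' n - c n) * (x - 0) ^ n) sums (0::complex)"
        if "norm (x - 0) < 1" for x :: complex
        using sums_diff[OF s'[of x] sums[of x]] that by (simp add: algebra_simps)
      have nz: "of_int (c' m - c m) \<noteq> (0 :: complex)" using m by simp
      show False
      proof (rule powser_0_nonzero[of 1 0 "\<lambda>n. of_int (c' n - c n)" "\<lambda>_. 0" m,
              OF zero_less_one z refl nz \<open>m > 0\<close>])
        fix s :: real
        assume "0 < s" and s: "\<And>w::complex. w \<in> cball 0 s - {0} \<Longrightarrow> (0::complex) \<noteq> 0"
        thus False using s[of "of_real s"] by simp
      qed
    qed
    thus "c' = c" by (rule ext)
  qed
qed

lemma lambda_coeff_0:
  "a > 0 \<Longrightarrow> b > 0 \<Longrightarrow> lambda_coeff a b 0 = 0"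
  using theI'[OF lambda_coeff_ex1[of a b]] by (simp add: lambda_coeff_def)

lemma lambda_coeff_sums:
  fixes q :: complex
  assumes "a > 0" "b > 0" "norm q < 1"
  shows "(\<lambda>n. of_int (lambda_coeff a b (Suc n)) * q ^ Suc n) sums eta_cube_prod a b q"
  using theI'[OF lambda_coeff_ex1[OF assms(1,2)]] assms(3)
  unfolding lambda_coeff_def by blast

text \<open>The representation sets are finite, so sums over them are genuine finite sums.\<close>

lemma finite_representations:
  fixes d N :: int
  assumes "d > 0"
  shows "finite {(x :: int, y :: int). x\<^sup>2 + d * y\<^sup>2 = N}"
proof (rule finite_subset)
  have sq: "\<bar>z\<bar> \<le> z\<^sup>2" for z :: int
    using self_le_power[of "\<bar>z\<bar>" 2] by (cases "z = 0") auto
  show "{(x, y). x\<^sup>2 + d * y\<^sup>2 = N} \<subseteq> {- N..N} \<times> {- N..N}"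
  proof clarify
    fix x y :: int
    assume "N = x\<^sup>2 + d * y\<^sup>2"
    moreover have "1 * y\<^sup>2 \<le> d * y\<^sup>2" using assms by (intro mult_right_mono) auto
    moreover have "0 \<le> x\<^sup>2" "0 \<le> y\<^sup>2" by auto
    ultimately show "x \<in> {- (x\<^sup>2 + d * y\<^sup>2)..x\<^sup>2 + d * y\<^sup>2} \<and> y \<in> {- (x\<^sup>2 + d * y\<^sup>2)..x\<^sup>2 + d * y\<^sup>2}"
      using sq[of x] sq[of y] unfolding atLeastAtMost_iff by linarith
  qed
qed auto

end

theory Submission
  imports Defs
begin

text \<open>
  Jacobi's identity for the cube of Euler's product, in the form
  \[ \prod_{k \ge 1} (1 - q^k)^3 = \sum_{u \equiv 1\ (4)} u\, q^{(u^2-1)/8}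
     \qquad (u \in \mathbb{Z}), \]
  turns a product of two such cubes into a double series and so gives, for all positive
  \<open>a\<close>, \<open>b\<close> and all \<open>N\<close> (\<open>lambda_coeff_eq_sum_reps\<close>),
  \[ \lambda(a,b;N) = \sum u v \quad\mbox{over } u \equiv v \equiv 1\ (4),\
     a u^2 + b v^2 = 8(N-1) + a + b. \]
  For \<open>a = 1\<close>, \<open>b = d\<close> with \<open>d = 3\<close>, \<open>N = n + 1\<close>, or \<open>d = 7\<close>, \<open>N = 2n + 1\<close>, the equation reads
  \<open>u\<^sup>2 + d v\<^sup>2 = (d + 1) M\<close> with \<open>M = 2n + 1\<close>. As \<open>d + 1\<close> is the norm of \<open>1 + sqrt (-d)\<close>,
  solutions arise from those of \<open>x\<^sup>2 + d y\<^sup>2 = M\<close> through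
  \<open>u + v sqrt (-d) = (x + y sqrt (-d)) (1 + sqrt (-d))\<close>, that is \<open>u = x - d y\<close> and \<open>v = x + y\<close>.
  Every solution \<open>(u, v)\<close> arises in this way because \<open>d + 1\<close> divides \<open>v - u\<close>: for \<open>d = 3\<close> by
  the congruences modulo 4, for \<open>d = 7\<close> because \<open>M\<close> is odd (\<open>reps_7_cong\<close>). In the
  new coordinates \<open>u v = x\<^sup>2 - (d - 1) x y - d y\<^sup>2\<close>. The condition
  \<open>x + y \<equiv> 1\<close> modulo 4 picks one point from each pair \<open>\<plusminus>(x, y)\<close>, whence the factor 1/2, and the
  cross terms \<open>x y\<close> cancel under \<open>y \<mapsto> -y\<close> (\<open>half_sum_reps\<close>).

  Jacobi's identity itself is the limit \<open>n \<rightarrow> \<infinity>\<close> of a finite identity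
  (\<open>jacobi_finite\<close>), obtained by differentiating the finite Jacobi triple product
  \[ \prod_{k=0}^{n} (1 - z q^k) \prod_{k=1}^{n} (1 - q^k/z) \]
  at its zero \<open>z = 1\<close>. No derivative is taken below: the coefficients in \<open>z\<close>
  satisfy a recurrence in \<open>n\<close>, under which their sum with the weights \<open>2j + 1\<close> is multiplied by
  \<open>(1 - q ^ (n + 1))\<^sup>2\<close>.
\<close>

section \<open>A finite form of Jacobi's identity\<close>

definition qfact :: "'a \<Rightarrow> nat \<Rightarrow> 'a :: field" where
  "qfact q n = (\<Prod>k<n. 1 - q ^ Suc k)"

lemma qfact_0 [simp]: "qfact q 0 = 1"
  by (simp add: qfact_def)

lemma qfact_Suc: "qfact q (Suc n) = qfact q n * (1 - q ^ Suc n)"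
  by (simp add: qfact_def)

text \<open>
  Up to sign, the coefficient of \<open>z ^ (j + 1)\<close> in the finite triple product above. The product has
  degrees \<open>-n\<close> to \<open>n + 1\<close> in \<open>z\<close> and is antisymmetric about \<open>1/2\<close>, so the
  coefficients with \<open>j \<ge> 0\<close> determine the others, the one for \<open>j = -1\<close>
  being the negative of the one for \<open>j = 0\<close>.
\<close>

definition jacobi_coeff :: "'a :: field \<Rightarrow> nat \<Rightarrow> nat \<Rightarrow> 'a" where
  "jacobi_coeff q n j = (if j \<le> n then
     (-1) ^ j * q ^ (\<Sum>{..j}) * qfact q (2 * n + 1) / (qfact q (n - j) * qfact q (n + 1 + j)) else 0)"

text \<open>
  Passing from \<open>n\<close> to \<open>n + 1\<close> multiplies the triple product by
  \<open>(1 - z Q) (1 - Q / z) = 1 + Q\<^sup>2 - Q (z + 1 / z)\<close>; comparing coefficients gives the recurrence. The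
  \<open>case\<close> expression is the coefficient at \<open>j - 1\<close>, with the antisymmetric value at
  \<open>-1\<close>. In the generic case all terms are multiples of one common quotient \<open>X\<close>,
  and what remains is a polynomial identity in \<open>q\<close>, \<open>w = q ^ (n - j)\<close> and \<open>t = q ^ j\<close>.
\<close>

lemma jacobi_coeff_Suc:
  fixes q :: "'a :: field"
  assumes nz: "\<And>n. qfact q n \<noteq> 0"
  assumes j: "j \<le> Suc n"
  defines "Q \<equiv> q ^ Suc n"
  defines "A \<equiv> jacobi_coeff q n"
  shows "jacobi_coeff q (Suc n) j =
    (1 + Q\<^sup>2) * A j - Q * ((case j of 0 \<Rightarrow> - A 0 | Suc i \<Rightarrow> A i) + A (Suc j))"
proof (cases "j = Suc n")
  case True
  show ?thesis
    using nz[of "2 * n + 1"] nz[of "2 * n + 3"]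
    by (simp add: True A_def Q_def jacobi_coeff_def mult_2 eval_nat_numeral power_add)
next
  case False
  with j obtain m where m: "n = j + m"
    by (auto simp: le_Suc_eq dest: le_Suc_ex)
  define X where "X = (-1) ^ j * q ^ (\<Sum>{..j}) * qfact q (2 * n + 1) /
                        (qfact q (Suc m) * qfact q (n + 2 + j))"
  define w t where "w = q ^ m" and "t = q ^ j"
  have Q: "Q = w * t * q"
    by (simp add: Q_def w_def t_def m power_add)
  have wnz: "1 - w * q \<noteq> 0"
    using nz[of "Suc m"] by (simp add: qfact_Suc w_def mult.commute)
  have nz2: "1 - w * t\<^sup>2 * q\<^sup>2 \<noteq> 0" "1 - w * t\<^sup>2 * q \<noteq> 0"
    using nz[of "n + 2 + j"]
    by (auto simp: qfact_Suc w_def t_def m power_add power2_eq_square mult_ac)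
  have new: "jacobi_coeff q (Suc n) j = X * (1 - w\<^sup>2 * t\<^sup>2 * q\<^sup>2) * (1 - w\<^sup>2 * t\<^sup>2 * q ^ 3)"
  proof -
    have "qfact q (2 * Suc n + 1) =
            qfact q (2 * n + 1) * (1 - w\<^sup>2 * t\<^sup>2 * q\<^sup>2) * (1 - w\<^sup>2 * t\<^sup>2 * q ^ 3)"
    proof -
      have "q ^ (2 * n) = w\<^sup>2 * t\<^sup>2"
        by (simp add: w_def t_def m power_even_eq power_add power_mult_distrib)
      thus ?thesis
        by (simp add: qfact_Suc power2_eq_square power3_eq_cube mult_ac)
    qed
    thus ?thesis using m by (simp add: jacobi_coeff_def X_def Suc_diff_le)
  qed
  have mid: "A j = X * (1 - w * q) * (1 - w * t\<^sup>2 * q\<^sup>2)"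
  proof -
    have "qfact q (Suc m) = qfact q m * (1 - w * q)"
         "qfact q (n + 2 + j) = qfact q (n + 1 + j) * (1 - w * t\<^sup>2 * q\<^sup>2)"
      by (simp_all add: qfact_Suc w_def t_def m power_add power2_eq_square mult_ac)
    thus ?thesis using m wnz nz2
      by (simp add: A_def jacobi_coeff_def X_def)
  qed
  have right: "A (Suc j) = - (X * t * q * (1 - w) * (1 - w * q))"
  proof (cases m)
    case 0
    thus ?thesis using m by (simp add: A_def jacobi_coeff_def w_def)
  next
    case (Suc l)
    have "qfact q (Suc m) = qfact q l * (1 - w) * (1 - w * q)"
      by (simp add: qfact_Suc w_def Suc mult_ac)
    moreover have "1 - w \<noteq> 0" using nz[of m] by (simp add: qfact_Suc w_def Suc)
    ultimately show ?thesis using m wnz Suc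
      by (simp add: A_def jacobi_coeff_def X_def t_def power_add divide_simps)
  qed
  have left: "t * (case j of 0 \<Rightarrow> - A 0 | Suc i \<Rightarrow> A i) =
                - (X * (1 - w * t\<^sup>2 * q) * (1 - w * t\<^sup>2 * q\<^sup>2))"
  proof (cases j)
    case 0
    have t1: "t = 1" by (simp add: t_def 0)
    show ?thesis using mid by (simp add: 0 t1)
  next
    case (Suc i)
    have "qfact q (n + 2 + j) = qfact q (n + j) * (1 - w * t\<^sup>2 * q) * (1 - w * t\<^sup>2 * q\<^sup>2)"
      by (simp add: qfact_Suc w_def t_def m power_add power2_eq_square mult_ac)
    moreover have "n - i = Suc m" "i \<le> n" "n + Suc i = n + j" using m Suc by auto
    moreover have "q ^ (\<Sum>{..j}) = t * q ^ (\<Sum>{..i})"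
      by (simp add: Suc t_def power_add)
    ultimately show ?thesis using nz2
      by (simp add: A_def jacobi_coeff_def X_def Suc divide_simps)
  qed
  have "(1 + Q\<^sup>2) * A j - Q * ((case j of 0 \<Rightarrow> - A 0 | Suc i \<Rightarrow> A i) + A (Suc j)) =
        (1 + Q\<^sup>2) * A j - w * q * (t * (case j of 0 \<Rightarrow> - A 0 | Suc i \<Rightarrow> A i)) - Q * A (Suc j)"
    by (simp add: Q algebra_simps)
  also have "\<dots> = X * (1 - w\<^sup>2 * t\<^sup>2 * q\<^sup>2) * (1 - w\<^sup>2 * t\<^sup>2 * q ^ 3)"
    unfolding left mid right Q by algebra
  finally show ?thesis using new by simp
qed

text \<open>
  The weight \<open>2 j + 1\<close> is odd about \<open>-1/2\<close>, like the coefficients, so both shifts by one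
  together contribute \<open>(2 j + 3) + (2 j - 1) = 2 (2 j + 1)\<close> to the coefficient of \<open>f j\<close>, the boundary terms
  \<open>\<plusminus> f 0\<close> cancel, and the factor is \<open>1 + Q\<^sup>2 - 2 Q\<close>.
\<close>

lemma weighted_sum_recurrence:
  fixes f :: "nat \<Rightarrow> 'a :: comm_ring_1"
  assumes f: "\<And>j. j > n \<Longrightarrow> f j = 0"
  shows "(\<Sum>j\<le>Suc n. of_nat (2 * j + 1) *
            ((1 + Q\<^sup>2) * f j - Q * ((case j of 0 \<Rightarrow> - f 0 | Suc i \<Rightarrow> f i) + f (Suc j)))) =
         (1 - Q)\<^sup>2 * (\<Sum>j\<le>n. of_nat (2 * j + 1) * f j)"
proof -
  define S where "S = (\<Sum>j\<le>n. of_nat (2 * j + 1) * f j)"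
  define R where "R = (\<Sum>j\<le>n. f j)"
  have up: "(\<Sum>j\<le>Suc n. of_nat (2 * j + 1) * f j) = S"
    using f by (simp add: S_def)
  have left: "(\<Sum>j\<le>Suc n. of_nat (2 * j + 1) * (case j of 0 \<Rightarrow> - f 0 | Suc i \<Rightarrow> f i)) = S + 2 * R - f 0"
  proof -
    have "(\<Sum>j\<le>n. of_nat (2 * Suc j + 1) * f j) = (\<Sum>j\<le>n. of_nat (2 * j + 1) * f j + 2 * f j)"
      by (intro sum.cong) (auto simp: algebra_simps)
    thus ?thesis
      unfolding sum.atMost_Suc_shift by (simp add: S_def R_def sum.distrib sum_distrib_left)
  qed
  have "(\<Sum>j\<le>Suc n. of_nat (2 * j + 1) * f (Suc j)) =
        (\<Sum>j\<le>Suc (Suc n). (of_nat (2 * j + 1) - 2) * f j) + f 0"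
    unfolding sum.atMost_Suc_shift[of _ "Suc n"] by (simp add: algebra_simps)
  also have "\<dots> = S - 2 * R + f 0"
    using f by (simp add: S_def R_def sum.distrib sum_distrib_left algebra_simps sum_subtractf)
  finally have right: "(\<Sum>j\<le>Suc n. of_nat (2 * j + 1) * f (Suc j)) = S - 2 * R + f 0" .
  have "(\<Sum>j\<le>Suc n. of_nat (2 * j + 1) *
            ((1 + Q\<^sup>2) * f j - Q * ((case j of 0 \<Rightarrow> - f 0 | Suc i \<Rightarrow> f i) + f (Suc j)))) =
        (1 + Q\<^sup>2) * (\<Sum>j\<le>Suc n. of_nat (2 * j + 1) * f j)
        - Q * ((\<Sum>j\<le>Suc n. of_nat (2 * j + 1) * (case j of 0 \<Rightarrow> - f 0 | Suc i \<Rightarrow> f i)) +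
               (\<Sum>j\<le>Suc n. of_nat (2 * j + 1) * f (Suc j)))"
    by (simp only: sum_distrib_left sum.distrib[symmetric] sum_subtractf[symmetric])
       (intro sum.cong refl; simp only: algebra_simps)
  also have "\<dots> = (1 - Q)\<^sup>2 * S"
    unfolding up left right by (simp add: power2_eq_square algebra_simps)
  finally show ?thesis by (simp only: S_def)
qed

lemma jacobi_finite:
  fixes q :: "'a :: field"
  assumes nz: "\<And>n. qfact q n \<noteq> 0"
  shows "(\<Sum>j\<le>n. of_nat (2 * j + 1) * jacobi_coeff q n j) = (qfact q n)\<^sup>2"
proof (induction n)
  case 0
  show ?case using nz[of 1] by (simp add: jacobi_coeff_def)
next
  case (Suc n)
  have "(\<Sum>j\<le>Suc n. of_nat (2 * j + 1) * jacobi_coeff q (Suc n) j) =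
        (\<Sum>j\<le>Suc n. of_nat (2 * j + 1) * ((1 + (q ^ Suc n)\<^sup>2) * jacobi_coeff q n j - q ^ Suc n *
           ((case j of 0 \<Rightarrow> - jacobi_coeff q n 0 | Suc i \<Rightarrow> jacobi_coeff q n i) + jacobi_coeff q n (Suc j))))"
    by (intro sum.cong refl arg_cong2[where f = times] jacobi_coeff_Suc nz) simp
  also have "\<dots> = (1 - q ^ Suc n)\<^sup>2 * (\<Sum>j\<le>n. of_nat (2 * j + 1) * jacobi_coeff q n j)"
    by (rule weighted_sum_recurrence) (simp add: jacobi_coeff_def)
  also have "\<dots> = (qfact q (Suc n))\<^sup>2"
    unfolding Suc.IH qfact_Suc power_mult_distrib by (rule mult.commute)
  finally show ?case .
qed

section \<open>Jacobi's identity for the cube of Euler's product\<close>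

definition euler_prod :: "complex \<Rightarrow> complex" where
  "euler_prod q = (\<Prod>k. 1 - q ^ Suc k)"

lemma convergent_prod_euler:
  fixes q :: complex
  assumes "norm q < 1"
  shows "convergent_prod (\<lambda>k. 1 - q ^ Suc k)"
proof (rule abs_convergent_prod_imp_convergent_prod)
  have "summable (\<lambda>k. norm q ^ Suc k)"
    using assms by (subst summable_Suc_iff) (auto intro: summable_geometric)
  thus "abs_convergent_prod (\<lambda>k. 1 - q ^ Suc k)"
    by (simp add: abs_convergent_prod_conv_summable norm_mult norm_power)
qed

lemma power_Suc_neq_1:
  fixes q :: complex
  assumes "norm q < 1"
  shows "q ^ Suc k \<noteq> 1"
proof
  assume "q ^ Suc k = 1"
  hence "norm q ^ Suc k = 1" by (metis norm_one norm_power)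
  moreover have "norm q * norm q ^ k \<le> norm q * 1"
    using assms by (intro mult_left_mono power_le_one) auto
  ultimately show False using assms by simp
qed

lemma qfact_nonzero:
  fixes q :: complex
  shows "norm q < 1 \<Longrightarrow> qfact q n \<noteq> 0"
  using power_Suc_neq_1[of q] by (auto simp: qfact_def simp del: power_Suc)

lemma euler_prod_nonzero: "norm q < 1 \<Longrightarrow> euler_prod q \<noteq> 0"
  unfolding euler_prod_def using power_Suc_neq_1[of q]
  by (intro prodinf_nonzero convergent_prod_euler) (auto simp del: power_Suc)

lemma qfact_tendsto: "norm q < 1 \<Longrightarrow> qfact q \<longlonglongrightarrow> euler_prod q"
  using convergent_prod_LIMSEQ[OF convergent_prod_euler, of q]
  unfolding qfact_def euler_prod_def
  by (subst LIMSEQ_lessThan_iff_atMost[of "\<lambda>A. \<Prod>k\<in>A. 1 - q ^ Suc k"])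

lemma summable_odd_geometric:
  fixes r :: real
  assumes "0 \<le> r" "r < 1"
  shows "summable (\<lambda>j. real (2 * j + 1) * r ^ j)"
proof (rule summable_comparison_test')
  show "summable (\<lambda>j. 2 * (of_nat (Suc j) * r ^ j))"
    using geometric_deriv_sums[of r] assms by (intro summable_mult) (auto simp: sums_iff)
  show "norm (real (2 * j + 1) * r ^ j) \<le> 2 * (of_nat (Suc j) * r ^ j)" for j
    using assms by (simp add: algebra_simps)
qed

text \<open>
  In the finite identity, for fixed \<open>j\<close> the left-hand summand tends to the \<open>j\<close>-th term of the series divided by
  \<open>euler_prod q\<close>, since \<open>qfact q n\<close> tends to that nonzero limit. For the same reason
  \<open>qfact q n\<close> and its inverse are bounded, which gives a summable majorant
  independent of \<open>n\<close>, and Tannery's theorem allows passing to the limit.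
\<close>

theorem jacobi_euler_prod_cube:
  fixes q :: complex
  assumes q: "norm q < 1"
  shows "summable (\<lambda>j. norm (of_int ((-1) ^ j * (2 * int j + 1)) * q ^ \<Sum>{..j}))"
    and "(\<lambda>j. of_int ((-1) ^ j * (2 * int j + 1)) * q ^ \<Sum>{..j}) sums (euler_prod q ^ 3)"
proof -
  note lim = qfact_tendsto[OF q] and nz = qfact_nonzero[OF q] and Lnz = euler_prod_nonzero[OF q]
  define L where "L = euler_prod q"
  define b where "b j = of_int ((-1) ^ j * (2 * int j + 1)) * q ^ \<Sum>{..j}" for j
  define M where "M j = real (2 * j + 1) * norm q ^ j" for j
  have b_le: "norm (b j) \<le> M j" for j
  proof -
    have "j \<le> \<Sum>{..j}" by (cases j) auto
    hence "norm q ^ \<Sum>{..j} \<le> norm q ^ j"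
      using q by (intro power_decreasing) auto
    moreover have "norm (b j) = real (2 * j + 1) * norm q ^ \<Sum>{..j}"
    proof -
      have "norm (of_int ((-1) ^ j * (2 * int j + 1)) :: complex) = real (2 * j + 1)"
        by (subst norm_of_int) (simp add: abs_mult)
      thus ?thesis by (simp only: b_def norm_mult norm_power)
    qed
    ultimately show ?thesis by (simp add: M_def mult_left_mono)
  qed
  have sm: "summable M"
    unfolding M_def using q by (intro summable_odd_geometric) auto
  have sb: "summable (\<lambda>j. norm (b j))"
    using b_le by (intro summable_comparison_test'[OF sm, where N = 0]) simp
  obtain B where B: "\<And>n. norm (qfact q n) \<le> B"
    using Bseq_def[of "qfact q"] convergent_imp_Bseq[of "qfact q"] lim convergent_def by metis
  have "(\<lambda>n. inverse (qfact q n)) \<longlonglongrightarrow> inverse L"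
    using Lnz unfolding L_def by (intro tendsto_inverse lim)
  then obtain C where C: "\<And>n. norm (inverse (qfact q n)) \<le> C"
    using Bseq_def[of "\<lambda>n. inverse (qfact q n)"] convergent_imp_Bseq[of "\<lambda>n. inverse (qfact q n)"]
      convergent_def by metis
  have BC: "B \<ge> 0" "C \<ge> 0" using B[of 0] C[of 0] by auto
  define a where "a j n = of_nat (2 * j + 1) * jacobi_coeff q n j" for j n
  have a_eq: "a j n = (if j \<le> n then b j * (qfact q (2 * n + 1) *
                 (inverse (qfact q (n - j)) * inverse (qfact q (n + 1 + j)))) else 0)" for j n
    by (simp add: a_def b_def jacobi_coeff_def divide_inverse mult_ac)
  have a_le: "norm (a j n) \<le> M j * (B * (C * C))" for j n
    using BC order_trans[OF norm_ge_zero b_le] unfolding a_eq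
    by (auto simp: norm_mult simp del: norm_inverse
             intro!: mult_mono b_le B C mult_nonneg_nonneg)
  have a_lim: "a j \<longlonglongrightarrow> b j * (L * (inverse L * inverse L))" for j
  proof (rule Lim_transform_eventually)
    show "\<forall>\<^sub>F n in sequentially. b j * (qfact q (2 * n + 1) *
            (inverse (qfact q (n - j)) * inverse (qfact q (n + 1 + j)))) = a j n"
      using eventually_ge_at_top[of j] by eventually_elim (simp add: a_eq)
    have f: "filterlim (\<lambda>n. 2 * n + 1 :: nat) at_top at_top"
            "filterlim (\<lambda>n. n - j) at_top at_top"
            "filterlim (\<lambda>n. n + 1 + j) at_top at_top"
      by (rule filterlim_subseq, simp add: strict_mono_def)
         (rule filterlim_minus_const_nat_at_top,
          rule filterlim_subseq, simp add: strict_mono_def)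
    show "(\<lambda>n. b j * (qfact q (2 * n + 1) *
            (inverse (qfact q (n - j)) * inverse (qfact q (n + 1 + j))))) \<longlonglongrightarrow>
            b j * (L * (inverse L * inverse L))"
      using Lnz unfolding L_def
      by (intro tendsto_intros filterlim_compose[OF lim] f)
  qed
  have "(\<lambda>n. suminf (\<lambda>j. a j n)) \<longlonglongrightarrow> (\<Sum>j. b j * (L * (inverse L * inverse L)))"
    using tannerys_theorem[of a "\<lambda>j. b j * (L * (inverse L * inverse L))" sequentially
        "\<lambda>j. M j * (B * (C * C))"] a_lim a_le sm
    by (auto intro: summable_mult2 always_eventually)
  moreover have "suminf (\<lambda>j. a j n) = (qfact q n)\<^sup>2" for n
  proof -
    have "suminf (\<lambda>j. a j n) = (\<Sum>j\<le>n. a j n)"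
      by (rule suminf_finite) (auto simp: a_eq)
    thus ?thesis using jacobi_finite[OF nz] by (simp add: a_def)
  qed
  ultimately have "(\<lambda>n. (qfact q n)\<^sup>2) \<longlonglongrightarrow> (\<Sum>j. b j * (L * (inverse L * inverse L)))" by simp
  moreover have "(\<lambda>n. (qfact q n)\<^sup>2) \<longlonglongrightarrow> L\<^sup>2"
    unfolding L_def by (intro tendsto_intros lim)
  ultimately have "(\<Sum>j. b j * (L * (inverse L * inverse L))) = L\<^sup>2"
    by (rule LIMSEQ_unique)
  moreover have "(\<Sum>j. b j * (L * (inverse L * inverse L))) = suminf b * inverse L"
  proof -
    have "L * (inverse L * inverse L) = inverse L" using Lnz by (simp add: L_def)
    thus ?thesis by (simp only: suminf_mult2[OF summable_norm_cancel[OF sb]])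
  qed
  ultimately have "suminf b = L ^ 3"
    using Lnz by (simp add: L_def field_simps power2_eq_square power3_eq_cube)
  thus "(\<lambda>j. of_int ((-1) ^ j * (2 * int j + 1)) * q ^ \<Sum>{..j}) sums (euler_prod q ^ 3)"
    using summable_sums[OF summable_norm_cancel[OF sb]] by (simp only: b_def[symmetric] L_def)
  show "summable (\<lambda>j. norm (of_int ((-1) ^ j * (2 * int j + 1)) * q ^ \<Sum>{..j}))"
    using sb by (simp only: b_def)
qed

text \<open>
  The signed odd number \<open>u = (-1) ^ j * (2 * j + 1)\<close> runs exactly once through the integers
  congruent to 1 modulo 4, and the triangular number \<open>1 + ... + j\<close> equals \<open>(u\<^sup>2 - 1) / 8\<close>.
  This absorbs the sign and makes the exponents a quadratic form.
\<close>

definition tri_index :: "int \<Rightarrow> nat" where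
  "tri_index u = nat ((u\<^sup>2 - 1) div 8)"

lemma tri_index_eq:
  assumes "u mod 4 = 1"
  shows "8 * int (tri_index u) = u\<^sup>2 - 1"
proof -
  obtain k where k: "u = 4 * k + 1"
    using assms by (metis mult_div_mod_eq)
  have e: "u\<^sup>2 - 1 = 8 * (k * (2 * k + 1))"
    by (simp add: k power2_eq_square algebra_simps)
  have "k * (2 * k + 1) \<ge> 0"
    by (cases "k \<ge> 0") (auto intro: mult_nonneg_nonneg mult_nonpos_nonpos)
  thus ?thesis unfolding tri_index_def e by simp
qed

lemma eight_times_triangular: "8 * int (\<Sum>{..j}) = (2 * int j + 1)\<^sup>2 - 1"
  by (induction j) (auto simp: power2_eq_square algebra_simps)

lemma bij_signed_odd:
  "bij_betw (\<lambda>j. (-1) ^ j * (2 * int j + 1)) UNIV {u. u mod 4 = 1}"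
  \<comment> \<open>The index is recovered from \<open>\<bar>u\<bar> = 2 j + 1\<close>.\<close>
proof (rule bij_betw_byWitness[where f' = "\<lambda>u. nat ((\<bar>u\<bar> - 1) div 2)"])
  show "(\<lambda>j. (-1) ^ j * (2 * int j + 1)) ` UNIV \<subseteq> {u. u mod 4 = 1}"
  proof clarify
    fix j :: nat
    show "((-1) ^ j * (2 * int j + 1)) mod 4 = 1"
      by (cases "even j") (auto elim!: evenE oddE, presburger+)
  qed
  show "\<forall>u\<in>{u. u mod 4 = 1}. (-1) ^ nat ((\<bar>u\<bar> - 1) div 2) * (2 * int (nat ((\<bar>u\<bar> - 1) div 2)) + 1) = u"
  proof clarify
    fix u :: int
    assume "u mod 4 = 1"
    then obtain k where k: "u = 4 * k + 1" by (metis mult_div_mod_eq)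
    show "(-1) ^ nat ((\<bar>u\<bar> - 1) div 2) * (2 * int (nat ((\<bar>u\<bar> - 1) div 2)) + 1) = u"
    proof (cases "k \<ge> 0")
      case True
      hence "(\<bar>u\<bar> - 1) div 2 = 2 * k" using k by simp
      thus ?thesis using k True by (simp add: nat_mult_distrib power_mult)
    next
      case False
      hence "(\<bar>u\<bar> - 1) div 2 = 2 * (- k - 1) + 1" using k by simp
      moreover have "nat (2 * (- k - 1) + 1) = 2 * nat (- k - 1) + 1" using False by simp
      ultimately show ?thesis using k False by (simp add: power_mult)
    qed
  qed
qed (auto simp: abs_mult)

lemma euler_prod_cube_has_sum:
  fixes q :: complex
  assumes q: "norm q < 1"
  shows "(\<lambda>u. norm (of_int u * q ^ tri_index u)) summable_on {u. u mod 4 = 1}"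
    and "((\<lambda>u. of_int u * q ^ tri_index u) has_sum (euler_prod q ^ 3)) {u. u mod 4 = 1}"
proof -
  define h where "h j = (-1) ^ j * (2 * int j + 1)" for j
  have bij: "bij_betw h UNIV {u. u mod 4 = 1}"
    using bij_signed_odd by (simp add: h_def[abs_def])
  have tri: "\<Sum>{..j} = tri_index (h j)" for j
  proof -
    have "(h j)\<^sup>2 = (2 * int j + 1)\<^sup>2"
      by (simp add: h_def power_mult_distrib flip: power_mult)
    moreover have "8 * int (tri_index (h j)) = (h j)\<^sup>2 - 1"
      using bij_betwE[OF bij] by (intro tri_index_eq) auto
    ultimately show ?thesis using eight_times_triangular[of j] by linarith
  qed
  note J = jacobi_euler_prod_cube[OF q, folded h_def, unfolded tri]
  have "((\<lambda>j. of_int (h j) * q ^ tri_index (h j)) has_sum (euler_prod q ^ 3)) UNIV"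
    using norm_summable_imp_has_sum[OF J] .
  thus "((\<lambda>u. of_int u * q ^ tri_index u) has_sum (euler_prod q ^ 3)) {u. u mod 4 = 1}"
    by (simp add: has_sum_reindex_bij_betw[OF bij, of "\<lambda>u. of_int u * q ^ tri_index u"])
  have "(\<lambda>j. norm (of_int (h j) * q ^ tri_index (h j))) summable_on UNIV"
    by (rule summable_nonneg_imp_summable_on[OF J(1)]) simp
  thus "(\<lambda>u. norm (of_int u * q ^ tri_index u)) summable_on {u. u mod 4 = 1}"
    by (simp add: summable_on_reindex_bij_betw[OF bij, of "\<lambda>u. norm (of_int u * q ^ tri_index u)"])
qed

lemma has_sum_Times:
  fixes f :: "'i \<Rightarrow> complex" and g :: "'j \<Rightarrow> complex"
  assumes f: "(f has_sum S) A" "(\<lambda>x. norm (f x)) summable_on A"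
    and g: "(g has_sum T) B" "(\<lambda>y. norm (g y)) summable_on B"
  shows "((\<lambda>(x, y). f x * g y) has_sum (S * T)) (A \<times> B)"
proof (rule has_sum_SigmaI)
  show "((\<lambda>y. case (x, y) of (x, y) \<Rightarrow> f x * g y) has_sum (f x * T)) B" for x
    using has_sum_cmult_right[OF g(1)] by simp
  show "((\<lambda>x. f x * T) has_sum (S * T)) A"
    by (rule has_sum_cmult_left[OF f(1)])
  have "(\<lambda>(x, y). norm (f x) * norm (g y)) summable_on A \<times> B"
  proof (rule summable_on_SigmaI)
    show "((\<lambda>y. case (x, y) of (x, y) \<Rightarrow> norm (f x) * norm (g y)) has_sum
            (norm (f x) * (\<Sum>\<^sub>\<infinity>y\<in>B. norm (g y)))) B" for x
      using has_sum_cmult_right[OF has_sum_infsum[OF g(2)]] by simp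
    show "(\<lambda>x. norm (f x) * (\<Sum>\<^sub>\<infinity>y\<in>B. norm (g y))) summable_on A"
      by (intro summable_on_cmult_left f(2))
  qed auto
  hence "(\<lambda>p. norm (case p of (x, y) \<Rightarrow> f x * g y)) summable_on A \<times> B"
    by (simp add: case_prod_unfold norm_mult)
  thus "(\<lambda>(x, y). f x * g y) summable_on A \<times> B"
    by (rule abs_summable_summable)
qed

section \<open>The coefficients as sums over representations\<close>

text \<open>
  The condition is \<open>1 + a (u\<^sup>2 - 1) / 8 + b (v\<^sup>2 - 1) / 8 = N\<close>, cleared of denominators and of
  subtractions; the summand 1 comes from the factor \<open>q\<close> in front of the product.
\<close>

definition reps :: "nat \<Rightarrow> nat \<Rightarrow> nat \<Rightarrow> (int \<times> int) set" where
  "reps a b N = {(u, v). u mod 4 = 1 \<and> v mod 4 = 1 \<and>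
     int a * u\<^sup>2 + int b * v\<^sup>2 + 8 = 8 * int N + int a + int b}"

lemma reps_iff_tri_index:
  "(u, v) \<in> reps a b N \<longleftrightarrow> u mod 4 = 1 \<and> v mod 4 = 1 \<and> 1 + a * tri_index u + b * tri_index v = N"
proof (cases "u mod 4 = 1 \<and> v mod 4 = 1")
  case True
  hence e: "u\<^sup>2 = 8 * int (tri_index u) + 1" "v\<^sup>2 = 8 * int (tri_index v) + 1"
    using tri_index_eq[of u] tri_index_eq[of v] by auto
  have "(u, v) \<in> reps a b N \<longleftrightarrow> 8 * (1 + int a * int (tri_index u) + int b * int (tri_index v)) = 8 * int N"
    using True by (auto simp: reps_def e algebra_simps)
  also have "\<dots> \<longleftrightarrow> 1 + a * tri_index u + b * tri_index v = N"
    by (simp flip: of_nat_mult of_nat_add of_nat_Suc)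
  finally show ?thesis using True by simp
qed (auto simp: reps_def)

lemma finite_reps:
  assumes "a > 0" "b > 0"
  shows "finite (reps a b N)"
proof (rule finite_subset)
  define K where "K = 8 * int N + int a + int b"
  have sq: "\<bar>z\<bar> \<le> int m * z\<^sup>2" if "m > 0" for z :: int and m
  proof -
    have "\<bar>z\<bar> \<le> z\<^sup>2"
      using self_le_power[of "\<bar>z\<bar>" 2] by (cases "z = 0") auto
    also have "1 * z\<^sup>2 \<le> int m * z\<^sup>2" using that by (intro mult_right_mono) auto
    finally show ?thesis by simp
  qed
  show "reps a b N \<subseteq> {-K..K} \<times> {-K..K}"
    using sq[OF assms(1)] sq[OF assms(2)] unfolding reps_def K_def
    by (clarsimp, smt (verit) abs_ge_zero)
qed simp

lemma eta_cube_prod_eq: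
  assumes "a > 0" "b > 0" "norm q < 1"
  shows "eta_cube_prod a b q = q * (euler_prod (q ^ a) ^ 3 * euler_prod (q ^ b) ^ 3)"
proof -
  have n: "norm (q ^ m) < 1" if "m > 0" for m
    using that assms(3) by (simp add: norm_power power_less_one_iff)
  have c: "convergent_prod (\<lambda>k. 1 - q ^ (m * Suc k))" if "m > 0" for m
    using convergent_prod_euler[OF n[OF that]] by (simp only: power_mult)
  show ?thesis
    unfolding eta_cube_prod_def euler_prod_def power_mult[symmetric]
    using c[OF assms(1)] c[OF assms(2)]
    by (simp only: prodinf_mult[symmetric] prodinf_power[symmetric] convergent_prod_power)
qed

text \<open>
  The absolutely convergent double series for the product of the two cubes is regrouped by the
  exponent of \<open>q\<close>, and the coefficients are identified by uniqueness of the expansion.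
\<close>

theorem lambda_coeff_eq_sum_reps:
  assumes ab: "a > 0" "b > 0"
  shows "lambda_coeff a b N = (\<Sum>(u, v) \<in> reps a b N. u * v)"
proof -
  define c where "c N = (\<Sum>(u, v) \<in> reps a b N. u * v)" for N
  define A where "A = {u :: int. u mod 4 = 1}"
  have c0: "c 0 = 0"
  proof -
    have "reps a b 0 = {}" by (auto simp: reps_iff_tri_index)
    thus ?thesis by (simp add: c_def)
  qed
  have "(\<lambda>n. of_int (c (Suc n)) * q ^ Suc n) sums eta_cube_prod a b q"
    if q: "norm q < 1" for q :: complex
  proof -
    have n: "norm (q ^ m) < 1" if "m > 0" for m
      using that q by (simp add: norm_power power_less_one_iff)
    define F where "F = (\<lambda>(u, v). of_int (u * v) * q ^ (1 + a * tri_index u + b * tri_index v))"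
    have "((\<lambda>p. q * (case p of (u, v) \<Rightarrow> (of_int u * (q ^ a) ^ tri_index u) * (of_int v * (q ^ b) ^ tri_index v)))
             has_sum (q * (euler_prod (q ^ a) ^ 3 * euler_prod (q ^ b) ^ 3))) (A \<times> A)"
      unfolding A_def
      by (intro has_sum_cmult_right has_sum_Times euler_prod_cube_has_sum n ab)
    also have "(\<lambda>p. q * (case p of (u, v) \<Rightarrow> (of_int u * (q ^ a) ^ tri_index u) * (of_int v * (q ^ b) ^ tri_index v))) = F"
      by (auto simp: F_def power_add power_mult fun_eq_iff)
    finally have "(F has_sum eta_cube_prod a b q) (A \<times> A)"
      using eta_cube_prod_eq[OF ab q] by simp
    also have "?this \<longleftrightarrow> ((\<lambda>(N, p). F p) has_sum eta_cube_prod a b q) (SIGMA N:UNIV. reps a b N)"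
      by (rule has_sum_reindex_bij_witness[where i = snd
            and j = "\<lambda>(u, v). (1 + a * tri_index u + b * tri_index v, (u, v))"])
         (auto simp: reps_iff_tri_index A_def)
    finally have "((\<lambda>N. of_int (c N) * q ^ N) has_sum eta_cube_prod a b q) UNIV"
    proof (rule has_sum_SigmaD)
      fix N
      have "(F has_sum (\<Sum>p\<in>reps a b N. F p)) (reps a b N)"
        by (intro has_sum_finite finite_reps ab)
      also have "(\<Sum>p\<in>reps a b N. F p) = (\<Sum>(u, v)\<in>reps a b N. of_int (u * v) * q ^ N)"
        by (intro sum.cong refl) (auto simp: F_def reps_iff_tri_index)
      also have "\<dots> = of_int (c N) * q ^ N"
        by (simp add: c_def sum_distrib_right case_prod_unfold)
      finally show "((\<lambda>p. case (N, p) of (N, p) \<Rightarrow> F p) has_sum (of_int (c N) * q ^ N)) (reps a b N)"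
        by simp
    qed
    hence "(\<lambda>N. of_int (c N) * q ^ N) sums eta_cube_prod a b q"
      by (rule has_sum_imp_sums)
    thus ?thesis
      using sums_Suc_iff[of "\<lambda>n. of_int (c n) * q ^ n" "eta_cube_prod a b q"] c0
      by (simp del: power_Suc)
  qed
  with c0 have "lambda_coeff a b = c"
    unfolding lambda_coeff_def by (intro the1_equality lambda_coeff_ex1 ab) blast
  thus ?thesis by (simp add: c_def)
qed

section \<open>Multiplication by \<open>1 + sqrt (-d)\<close>\<close>

text \<open>
  The map \<open>(x, y) \<mapsto> (x - d y, x + y)\<close> is multiplication by \<open>1 + sqrt (-d)\<close>, of norm \<open>d + 1\<close>.
  The divisibility assumption says that \<open>y = (v - u) / (d + 1)\<close> is integral, which is what
  surjectivity onto the representations needs. As 4 divides \<open>d + 1\<close>, both \<open>u\<close> and \<open>v\<close> are congruent to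
  \<open>x + y\<close> modulo 4. This residue is odd because \<open>M\<close> and \<open>d\<close> are, so the
  solutions split into the classes \<open>H 1\<close> and \<open>H 3\<close>, exchanged by negation.
\<close>

lemma half_sum_reps:
  fixes d :: nat and M :: int
  defines "S \<equiv> {(x :: int, y :: int). x\<^sup>2 + int d * y\<^sup>2 = M}"
  assumes d: "d > 0" "4 dvd d + 1" and M: "odd M"
    and N: "8 * int N + int d + 1 = 8 + (int d + 1) * M"
    and cong: "\<And>u v. (u, v) \<in> reps 1 d N \<Longrightarrow> int d + 1 dvd v - u"
  shows "2 * (\<Sum>(u, v) \<in> reps 1 d N. u * v) = (\<Sum>(x, y) \<in> S. x\<^sup>2 - int d * y\<^sup>2)"
proof -
  define H where "H r = {(x, y) \<in> S. (x + y) mod 4 = r}" for r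
  \<comment> \<open>This is \<open>u v\<close> in the coordinates \<open>x\<close>, \<open>y\<close>.\<close>
  define f where "f = (\<lambda>(x :: int, y). x\<^sup>2 - int d * y\<^sup>2 - (int d - 1) * (x * y))"
  have fin: "finite S" using finite_representations[of "int d" M] d by (simp add: S_def)
  obtain e where e: "int d + 1 = 4 * e" using d(2)
    by (metis dvdE int_dvd_int_iff of_nat_1 of_nat_add of_nat_numeral)
  have comp: "(x - int d * y)\<^sup>2 + int d * (x + y)\<^sup>2 = (int d + 1) * (x\<^sup>2 + int d * y\<^sup>2)" for x y
    by (simp add: power2_eq_square algebra_simps)
  have mod4: "(x - int d * y) mod 4 = (x + y) mod 4" for x y
  proof -
    have "x - int d * y = (x + y) + 4 * (- e * y)"
    proof -
      have "(x + y) + 4 * (- e * y) = (x + y) - (4 * e) * y" by simp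
      also have "\<dots> = x - int d * y" unfolding e[symmetric] by (simp add: algebra_simps)
      finally show ?thesis by simp
    qed
    thus ?thesis by (metis mod_mult_self2)
  qed
  have reps_iff: "(u, v) \<in> reps 1 d N \<longleftrightarrow>
      u mod 4 = 1 \<and> v mod 4 = 1 \<and> u\<^sup>2 + int d * v\<^sup>2 = (int d + 1) * M" for u v
    using N by (auto simp: reps_def)
  have "(\<Sum>(u, v) \<in> reps 1 d N. u * v) = (\<Sum>p \<in> H 1. f p)"
  proof (rule sum.reindex_bij_witness[where
        i = "\<lambda>(x, y). (x - int d * y, x + y)" and
        j = "\<lambda>(u, v). (v - (v - u) div (int d + 1), (v - u) div (int d + 1))"])
    fix p assume "p \<in> reps 1 d N"
    then obtain u v where p: "p = (u, v)" "(u, v) \<in> reps 1 d N" by (cases p) auto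
    obtain y where y: "v - u = (int d + 1) * y" using cong[OF p(2)] by blast
    define x where "x = v - y"
    have uv: "v = x + y" "u = x - int d * y"
      using y by (auto simp: x_def algebra_simps)
    have y': "(v - u) div (int d + 1) = y" unfolding y using d by simp
    have j: "(case p of (u, v) \<Rightarrow> (v - (v - u) div (int d + 1), (v - u) div (int d + 1))) = (x, y)"
      by (simp add: p y' x_def)
    show "(case (case p of (u, v) \<Rightarrow> (v - (v - u) div (int d + 1), (v - u) div (int d + 1))) of
             (x, y) \<Rightarrow> (x - int d * y, x + y)) = p"
      unfolding j by (simp add: p uv)
    have "(int d + 1) * (x\<^sup>2 + int d * y\<^sup>2) = (int d + 1) * M"
      using p(2) unfolding reps_iff uv comp by simp
    hence "x\<^sup>2 + int d * y\<^sup>2 = M" by simp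
    thus "(case p of (u, v) \<Rightarrow> (v - (v - u) div (int d + 1), (v - u) div (int d + 1))) \<in> H 1"
      unfolding j using p(2)[unfolded reps_iff] by (auto simp: H_def S_def uv)
    show "f (case p of (u, v) \<Rightarrow> (v - (v - u) div (int d + 1), (v - u) div (int d + 1))) =
            (case p of (u, v) \<Rightarrow> u * v)"
      unfolding j by (simp add: p uv f_def power2_eq_square algebra_simps)
  next
    fix p assume "p \<in> H 1"
    then obtain x y where p: "p = (x, y)" "x\<^sup>2 + int d * y\<^sup>2 = M" "(x + y) mod 4 = 1"
      by (auto simp: H_def S_def)
    have "x + y - (x - int d * y) = (int d + 1) * y" by (simp add: algebra_simps)
    thus "(case (case p of (x, y) \<Rightarrow> (x - int d * y, x + y)) of (u, v) \<Rightarrow>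
            (v - (v - u) div (int d + 1), (v - u) div (int d + 1))) = p"
      using p d by simp
    show "(case p of (x, y) \<Rightarrow> (x - int d * y, x + y)) \<in> reps 1 d N"
      unfolding p(1) prod.case reps_iff comp mod4 using p(2,3) by simp
  qed
  moreover have "(\<Sum>p \<in> H 3. f p) = (\<Sum>p \<in> H 1. f p)"
  proof (rule sum.reindex_bij_witness[where i = "\<lambda>(x, y). (-x, -y)" and j = "\<lambda>(x, y). (-x, -y)"])
    have neg: "(- x - y) mod 4 = 3 \<longleftrightarrow> (x + y) mod 4 = (1 :: int)"
              "(- x - y) mod 4 = 1 \<longleftrightarrow> (x + y) mod 4 = (3 :: int)" for x y by presburger+
    show "(case p of (x, y) \<Rightarrow> (-x, -y)) \<in> H 1" if "p \<in> H 3" for p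
      using that by (auto simp: H_def S_def neg)
    show "(case p of (x, y) \<Rightarrow> (-x, -y)) \<in> H 3" if "p \<in> H 1" for p
      using that by (auto simp: H_def S_def neg)
  qed (auto simp: f_def)
  moreover have "(\<Sum>p \<in> S. f p) = (\<Sum>p \<in> H 1. f p) + (\<Sum>p \<in> H 3. f p)"
  proof -
    have "(x + y) mod 4 = 1 \<or> (x + y) mod 4 = 3" if "(x, y) \<in> S" for x y
    proof -
      have "odd (int d)" using e by presburger
      hence "odd (x + y)" using that M by (auto simp: S_def)
      thus ?thesis by presburger
    qed
    hence S: "S = H 1 \<union> H 3" by (auto simp: H_def)
    hence "finite (H 1)" "finite (H 3)" using fin by auto
    moreover have "H 1 \<inter> H 3 = {}" by (auto simp: H_def)
    ultimately have "sum f (H 1 \<union> H 3) = sum f (H 1) + sum f (H 3)"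
      by (rule sum.union_disjoint)
    thus ?thesis by (simp only: S)
  qed
  ultimately have "2 * (\<Sum>(u, v) \<in> reps 1 d N. u * v) = (\<Sum>p \<in> S. f p)" by simp
  also have "\<dots> = (\<Sum>(x, y) \<in> S. x\<^sup>2 - int d * y\<^sup>2) - (int d - 1) * (\<Sum>(x, y) \<in> S. x * y)"
    by (simp only: f_def case_prod_unfold sum_subtractf sum_distrib_left)
  also have "(\<Sum>(x, y) \<in> S. x * y) = 0"
  proof -
    have "(\<Sum>(x, y) \<in> S. x * y) = (\<Sum>(x, y) \<in> S. - (x * y))"
      by (rule sum.reindex_bij_witness[where i = "\<lambda>(x, y). (x, -y)" and j = "\<lambda>(x, y). (x, -y)"])
         (auto simp: S_def)
    thus ?thesis by (simp add: case_prod_unfold sum_negf)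
  qed
  finally show ?thesis by simp
qed

text \<open>
  With \<open>u = 4 k + 1\<close> and \<open>v = 4 l + 1\<close>, dividing \<open>u\<^sup>2 + 7 v\<^sup>2 = 8 N\<close> by 8 leaves
  \<open>N \<equiv> k + l + 1\<close> modulo 2, so \<open>k\<close> and \<open>l\<close> have the same parity.
\<close>

lemma reps_7_cong:
  assumes "(u, v) \<in> reps 1 7 N" "odd N"
  shows "8 dvd v - u"
proof -
  from assms(1) have m: "u mod 4 = 1" "v mod 4 = 1" and eq: "u\<^sup>2 + 7 * v\<^sup>2 = 8 * int N"
    by (auto simp: reps_def)
  from m obtain k l where k: "u = 4 * k + 1" "v = 4 * l + 1" by (metis mult_div_mod_eq)
  have "8 * (2 * k\<^sup>2 + k + 14 * l\<^sup>2 + 7 * l + 1) = 8 * int N"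
    using eq unfolding k by (simp add: power2_eq_square algebra_simps)
  hence "2 * k\<^sup>2 + k + 14 * l\<^sup>2 + 7 * l + 1 = int N" by simp
  hence "odd (2 * k\<^sup>2 + k + 14 * l\<^sup>2 + 7 * l + 1)" using assms(2) by simp
  hence "even (l - k)" by simp
  then obtain m where "l - k = 2 * m" by (elim evenE)
  hence "v - u = 8 * m" by (simp add: k)
  thus ?thesis by simp
qed

theorem theorem5p1:
  fixes n :: nat
  assumes "n > 0"
  shows "real_of_int (lambda_coeff 1 3 (n + 1)) =
           1 / 2 * (\<Sum>(x, y) \<in> {(x :: int, y :: int). x\<^sup>2 + 3 * y\<^sup>2 = 2 * int n + 1}.
                      real_of_int (x\<^sup>2 - 3 * y\<^sup>2)) \<and>
         real_of_int (lambda_coeff 1 7 (2 * n + 1)) =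
           1 / 2 * (\<Sum>(x, y) \<in> {(x :: int, y :: int). x\<^sup>2 + 7 * y\<^sup>2 = 2 * int n + 1}.
                      real_of_int (x\<^sup>2 - 7 * y\<^sup>2))"
proof -
  have "2 * lambda_coeff 1 3 (n + 1) =
          (\<Sum>(x, y) \<in> {(x :: int, y :: int). x\<^sup>2 + int 3 * y\<^sup>2 = 2 * int n + 1}. x\<^sup>2 - int 3 * y\<^sup>2)"
  proof (subst lambda_coeff_eq_sum_reps)
    have "4 dvd v - u" if "(u, v) \<in> reps 1 3 (n + 1)" for u v
      using that unfolding reps_def by (auto intro: mod_eq_dvd_iff[THEN iffD1])
    thus "2 * (\<Sum>(u, v) \<in> reps 1 3 (n + 1). u * v) =
       (\<Sum>(x, y) \<in> {(x :: int, y :: int). x\<^sup>2 + int 3 * y\<^sup>2 = 2 * int n + 1}. x\<^sup>2 - int 3 * y\<^sup>2)"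
      by (intro half_sum_reps) auto
  qed auto
  moreover have "2 * lambda_coeff 1 7 (2 * n + 1) =
          (\<Sum>(x, y) \<in> {(x :: int, y :: int). x\<^sup>2 + int 7 * y\<^sup>2 = 2 * int n + 1}. x\<^sup>2 - int 7 * y\<^sup>2)"
  proof (subst lambda_coeff_eq_sum_reps)
    show "2 * (\<Sum>(u, v) \<in> reps 1 7 (2 * n + 1). u * v) =
       (\<Sum>(x, y) \<in> {(x :: int, y :: int). x\<^sup>2 + int 7 * y\<^sup>2 = 2 * int n + 1}. x\<^sup>2 - int 7 * y\<^sup>2)"
      using reps_7_cong[of _ _ "2 * n + 1"] by (intro half_sum_reps) auto
  qed auto
  ultimately have
    "2 * real_of_int (lambda_coeff 1 3 (n + 1)) =
       real_of_int (\<Sum>(x, y) \<in> {(x :: int, y :: int). x\<^sup>2 + 3 * y\<^sup>2 = 2 * int n + 1}. x\<^sup>2 - 3 * y\<^sup>2)"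
    "2 * real_of_int (lambda_coeff 1 7 (2 * n + 1)) =
       real_of_int (\<Sum>(x, y) \<in> {(x :: int, y :: int). x\<^sup>2 + 7 * y\<^sup>2 = 2 * int n + 1}. x\<^sup>2 - 7 * y\<^sup>2)"
    by (simp_all only: of_int_eq_iff[where 'a = real, symmetric] of_int_mult of_int_numeral of_nat_numeral)
  thus ?thesis by (simp add: case_prod_unfold)
qed

end
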